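(* Let $G$ be a finitely generated group and let $\mathcal{VC}\text{yc}$ be the family of virtually cyclic subgroups of $G$. Then $\mathcal{VC}\text{yc-eq-asdim}\, G=0$ if and only if $G$ is virtually cyclic.
   Context: $G$ is discrete and equipped with a fixed word-length metric coming from a finite generating set; $\overline{B}(g,\alpha)$ denotes the closed ball in $G$. Virtually cyclic groups are groups with a cyclic (possibly trivial) subgroup of finite index. Let $\mathcal{F}$ be a family of subgroups of $G$, i.e. a set of subgroups closed under conjugation and under taking subgroups. Let $Y$ be a $G$-set. A subset $U\subseteq Y$ is an $\mathcal{F}$-subset if (a) any two elements $gU$, $g'U$ of its orbit are either equal or disjoint, and (b) its stabiliser $G_U=\{g\in G : gU=U\}$ belongs to $\mathcal{F}$. An $\mathcal{F}$-cover of $Y$ is a cover consisting of $\mathcal{F}$-subsets which is $G$-invariant as a family. It is open if its members are open. For a family $\mathcal{U}$ of subsets of a set $Y$, $\dim\mathcal{U}=\sup_{y\in Y}|\{U\in\mathcal{U} : y\in U\}|-1$. For a cover $\mathcal{U}$ of $G\times Y$, a number $\alpha<\infty$ is a $G$-Lebesgue number of $\mathcal{U}$ if for each $(g,y)\in G\times Y$ there is $U\in\mathcal{U}$ with $\overline{B}(g,\alpha)\times\{y\}\subseteq U$. For a compact $G$-space $\overline{X}$, $\mathcal{F}\text{-eq-asdim}\, G\times\overline{X}$ is the smallest integer $n$ such that for every $\alpha<\infty$ there is an open $\mathcal{F}$-cover $\mathcal{U}$ of $G\times\overline{X}$ (with the diagonal $G$-action $h(g,x)=(hg,hx)$) with $\dim\mathcal{U}\le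 n$ and having $\alpha$ as a $G$-Lebesgue number; it is infinite if no such $n$ exists. $\mathcal{F}\text{-eq-asdim}\, G$ denotes $\mathcal{F}\text{-eq-asdim}\, G\times\beta G$, where $\beta G$ is the Stone–Čech compactification of the discrete space $G$ with the action extending left multiplication; equivalently, it is the minimal value of $\mathcal{F}\text{-eq-asdim}\, G\times\overline{X}$ over nonempty compact Hausdorff $G$-spaces $\overline{X}$. *)

theory Defs
  imports "HOL-Analysis.Analysis" "HOL-Algebra.Elementary_Groups" "HOL-Library.Extended_Real"
begin

section \<open>Virtually cyclic subgroups\<close>

definition virtually_cyclic :: "('a, 'b) monoid_scheme \<Rightarrow> bool" where
  "virtually_cyclic G \<longleftrightarrow>
     (\<exists>C. subgroup C G \<and> cyclic_group (G\<lparr>carrier := C\<rparr>) \<and> finite (rcosets\<^bsub>G\<^esub> C))"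

definition VCyc :: "('a, 'b) monoid_scheme \<Rightarrow> 'a set set" where
  "VCyc G = {H. subgroup H G \<and> virtually_cyclic (G\<lparr>carrier := H\<rparr>)}"


section \<open>Word metrics\<close>

definition word_length :: "('a, 'b) monoid_scheme \<Rightarrow> 'a set \<Rightarrow> 'a \<Rightarrow> nat" where
  "word_length G S g =
     (LEAST n. \<exists>ws. length ws = n \<and> set ws \<subseteq> S \<union> (\<lambda>s. inv\<^bsub>G\<^esub> s) ` S \<and>
                    foldr (\<lambda>x y. x \<otimes>\<^bsub>G\<^esub> y) ws \<one>\<^bsub>G\<^esub> = g)"

text \<open>The left-invariant word metric, so that left translations are isometries.\<close>

definition word_dist :: "('a, 'b) monoid_scheme \<Rightarrow> 'a set \<Rightarrow> 'a \<Rightarrow> 'a \<Rightarrow> nat" where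
  "word_dist G S g h = word_length G S (inv\<^bsub>G\<^esub> g \<otimes>\<^bsub>G\<^esub> h)"

definition word_cball :: "('a, 'b) monoid_scheme \<Rightarrow> 'a set \<Rightarrow> 'a \<Rightarrow> real \<Rightarrow> 'a set" where
  "word_cball G S g \<alpha> = {h \<in> carrier G. real (word_dist G S g h) \<le> \<alpha>}"


section \<open>Covers of G-sets\<close>

text \<open>A \<open>G\<close>-set is given by its underlying set \<open>Y\<close> and a function \<open>act :: 'g \<Rightarrow> 'y \<Rightarrow> 'y\<close>.\<close>

definition F_subset ::
  "('g, 'b) monoid_scheme \<Rightarrow> 'g set set \<Rightarrow> 'y set \<Rightarrow> ('g \<Rightarrow> 'y \<Rightarrow> 'y) \<Rightarrow> 'y set \<Rightarrow> bool" where
  "F_subset G \<F> Y act U \<longleftrightarrow>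
     U \<subseteq> Y \<and>
     (\<forall>g\<in>carrier G. \<forall>g'\<in>carrier G. act g ` U = act g' ` U \<or> act g ` U \<inter> act g' ` U = {}) \<and>
     {g \<in> carrier G. act g ` U = U} \<in> \<F>"

definition F_cover ::
  "('g, 'b) monoid_scheme \<Rightarrow> 'g set set \<Rightarrow> 'y set \<Rightarrow> ('g \<Rightarrow> 'y \<Rightarrow> 'y) \<Rightarrow> 'y set set \<Rightarrow> bool" where
  "F_cover G \<F> Y act \<U> \<longleftrightarrow>
     (\<forall>U\<in>\<U>. F_subset G \<F> Y act U) \<and>
     \<Union>\<U> = Y \<and>
     (\<forall>g\<in>carrier G. \<forall>U\<in>\<U>. act g ` U \<in> \<U>)"

text \<open>The supremum is formed in \<^typ>\<open>enat\<close>, so it is \<open>0\<close> for empty \<open>Y\<close>; a point lying in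
  infinitely many members contributes \<open>\<infinity>\<close>.\<close>

definition cover_dim :: "'y set \<Rightarrow> 'y set set \<Rightarrow> ereal" where
  "cover_dim Y \<U> =
     ereal_of_enat (SUP y\<in>Y. if finite {U \<in> \<U>. y \<in> U} then enat (card {U \<in> \<U>. y \<in> U}) else \<infinity>) - 1"

definition G_Lebesgue_number ::
  "('g, 'b) monoid_scheme \<Rightarrow> 'g set \<Rightarrow> 'y set \<Rightarrow> ('g \<times> 'y) set set \<Rightarrow> real \<Rightarrow> bool" where
  "G_Lebesgue_number G S Y \<U> \<alpha> \<longleftrightarrow>
     (\<forall>g\<in>carrier G. \<forall>y\<in>Y. \<exists>U\<in>\<U>. word_cball G S g \<alpha> \<times> {y} \<subseteq> U)"


section \<open>Equivariant asymptotic dimension\<close>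

definition diag_act ::
  "('g, 'b) monoid_scheme \<Rightarrow> ('g \<Rightarrow> 'x \<Rightarrow> 'x) \<Rightarrow> 'g \<Rightarrow> 'g \<times> 'x \<Rightarrow> 'g \<times> 'x" where
  "diag_act G act h = (\<lambda>(g, x). (h \<otimes>\<^bsub>G\<^esub> g, act h x))"

text \<open>The set of admissible integers is upwards closed and bounded below by \<open>-1\<close>, so the infimum
  is its least element if it is nonempty, and \<open>\<infinity>\<close> if it is empty.\<close>

definition eq_asdim_prod ::
  "('g, 'b) monoid_scheme \<Rightarrow> 'g set \<Rightarrow> 'g set set \<Rightarrow> 'x topology \<Rightarrow> ('g \<Rightarrow> 'x \<Rightarrow> 'x) \<Rightarrow> ereal" where
  "eq_asdim_prod G S \<F> X act =
     Inf {ereal (of_int n) |n :: int.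
       \<forall>\<alpha>::real. \<exists>\<U>.
         F_cover G \<F> (carrier G \<times> topspace X) (diag_act G act) \<U> \<and>
         (\<forall>U\<in>\<U>. openin (prod_topology (discrete_topology (carrier G)) X) U) \<and>
         cover_dim (carrier G \<times> topspace X) \<U> \<le> ereal (of_int n) \<and>
         G_Lebesgue_number G S (topspace X) \<U> \<alpha>}"


section \<open>The Stone-Cech compactification of a discrete space\<close>

text \<open>The points are the ultrafilters on \<open>A\<close>, the principal ones being the points of \<open>A\<close>.\<close>

definition ultrafilters_on :: "'a set \<Rightarrow> 'a filter set" where
  "ultrafilters_on A =
     {F. F \<noteq> bot \<and> F \<le> principal A \<and> (\<forall>P. eventually P F \<or> eventually (\<lambda>x. \<not> P x) F)}"

definition stone_cech :: "'a set \<Rightarrow> 'a filter topology" where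
  "stone_cech A =
     topology_generated_by ((\<lambda>B. {F \<in> ultrafilters_on A. eventually (\<lambda>x. x \<in> B) F}) ` Pow A)"

definition stone_cech_act :: "('a, 'b) monoid_scheme \<Rightarrow> 'a \<Rightarrow> 'a filter \<Rightarrow> 'a filter" where
  "stone_cech_act G g F = filtermap (\<lambda>x. g \<otimes>\<^bsub>G\<^esub> x) F"

definition eq_asdim :: "('g, 'b) monoid_scheme \<Rightarrow> 'g set \<Rightarrow> 'g set set \<Rightarrow> ereal" where
  "eq_asdim G S \<F> = eq_asdim_prod G S \<F> (stone_cech (carrier G)) (stone_cech_act G)"


section \<open>The ultrafilter space satisfies the defining properties of the compactification\<close>

lemma ultrafilter_exists:
  fixes F :: "'a filter"
  assumes "F \<noteq> bot"
  shows "\<exists>U\<le>F. U \<noteq> bot \<and> (\<forall>P. eventually P U \<or> eventually (\<lambda>x. \<not> P x) U)"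
proof -
  let ?A = "{U. U \<noteq> bot \<and> U \<le> F}"
  have "\<exists>M\<in>?A. \<forall>a\<in>?A. M \<ge> a \<longrightarrow> a = M"
  proof (rule predicate_Zorn[where P = "\<lambda>x y. x \<ge> (y :: 'a filter)"])
    show "partial_order_on ?A (relation_of (\<lambda>x y. x \<ge> y) ?A)"
      by (auto simp: partial_order_on_def preorder_on_def refl_on_def trans_def antisym_def relation_of_def)
  next
    fix C :: "'a filter set" assume C: "C \<in> Chains (relation_of (\<lambda>x y. x \<ge> y) ?A)"
    hence CA: "C \<subseteq> ?A" and chain: "\<And>x y. x \<in> C \<Longrightarrow> y \<in> C \<Longrightarrow> x \<le> y \<or> y \<le> x"
      by (auto simp: Chains_def relation_of_def)
    show "\<exists>u\<in>?A. \<forall>a\<in>C. a \<ge> u"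
    proof (cases "C = {}")
      case True thus ?thesis using assms by auto
    next
      case False
      have "\<And>P. eventually P (Inf C) \<longleftrightarrow> (\<exists>b\<in>C. eventually P b)"
        by (rule eventually_Inf_base[OF False]) (metis chain inf.orderE inf.commute order_refl)
      hence "Inf C \<noteq> bot" using CA by (auto simp: trivial_limit_def simp del: eventually_False)
      moreover have "Inf C \<le> F" using False CA by (auto intro: Inf_lower2)
      ultimately show ?thesis by (auto intro!: bexI[of _ "Inf C"] Inf_lower)
    qed
  qed
  then obtain M where M: "M \<noteq> bot" "M \<le> F" "\<And>a. a \<noteq> bot \<Longrightarrow> a \<le> F \<Longrightarrow> a \<le> M \<Longrightarrow> a = M" by blast
  have "eventually P M \<or> eventually (\<lambda>x. \<not> P x) M" for P
  proof (cases "inf M (principal {x. P x}) = bot")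
    case True
    hence "eventually (\<lambda>x. False) (inf M (principal {x. P x}))" by simp
    thus ?thesis by (simp add: eventually_inf_principal)
  next
    case False
    hence "inf M (principal {x. P x}) = M" using M by (meson inf_le1 order_trans)
    moreover have "eventually P (inf M (principal {x. P x}))" by (simp add: eventually_inf_principal)
    ultimately show ?thesis by simp
  qed
  with M show ?thesis by blast
qed

lemma topspace_stone_cech [simp]: "topspace (stone_cech A) = ultrafilters_on A"
  by (auto simp: stone_cech_def ultrafilters_on_def le_principal)

lemma ultrafilters_onD:
  assumes "F \<in> ultrafilters_on A"
  shows "F \<noteq> bot" "eventually (\<lambda>x. x \<in> A) F" "\<not> eventually P F \<longleftrightarrow> eventually (\<lambda>x. \<not> P x) F"
proof -
  show "F \<noteq> bot" "eventually (\<lambda>x. x \<in> A) F" using assms by (auto simp: ultrafilters_on_def le_principal)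
  show "\<not> eventually P F \<longleftrightarrow> eventually (\<lambda>x. \<not> P x) F"
  proof
    assume "eventually (\<lambda>x. \<not> P x) F"
    show "\<not> eventually P F"
    proof
      assume "eventually P F"
      with \<open>eventually (\<lambda>x. \<not> P x) F\<close> have "eventually (\<lambda>x. False) F" by eventually_elim auto
      with \<open>F \<noteq> bot\<close> show False by (simp add: trivial_limit_def)
    qed
  qed (use assms in \<open>auto simp: ultrafilters_on_def\<close>)
qed

lemma openin_stone_cech_basic:
  "openin (stone_cech A) {F \<in> ultrafilters_on A. eventually P F}"
proof -
  have "{F \<in> ultrafilters_on A. eventually P F} = {F \<in> ultrafilters_on A. eventually (\<lambda>x. x \<in> {x\<in>A. P x}) F}"
    by (auto dest: ultrafilters_onD(2) elim: eventually_elim2 simp: eventually_conj_iff)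
  moreover have "openin (stone_cech A) \<dots>"
    unfolding stone_cech_def by (rule topology_generated_by_Basis, rule imageI) auto
  ultimately show ?thesis by simp
qed

lemma openin_stone_cech:
  assumes "openin (stone_cech A) W" "F \<in> W"
  shows "\<exists>B\<subseteq>A. eventually (\<lambda>x. x \<in> B) F \<and> (\<forall>F'\<in>ultrafilters_on A. eventually (\<lambda>x. x \<in> B) F' \<longrightarrow> F' \<in> W)"
proof -
  have "generate_topology_on ((\<lambda>B. {F \<in> ultrafilters_on A. eventually (\<lambda>x. x \<in> B) F}) ` Pow A) W"
    using assms(1) unfolding stone_cech_def by (rule openin_topology_generated_by)
  thus ?thesis using assms(2)
  proof (induction arbitrary: F)
    case (Int a b)
    from Int.prems obtain B B' where "B \<subseteq> A" "eventually (\<lambda>x. x \<in> B) F" "\<forall>F'\<in>ultrafilters_on A. eventually (\<lambda>x. x \<in> B) F' \<longrightarrow> F' \<in> a"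
      "eventually (\<lambda>x. x \<in> B') F" "\<forall>F'\<in>ultrafilters_on A. eventually (\<lambda>x. x \<in> B') F' \<longrightarrow> F' \<in> b"
      using Int.IH by (metis IntD1 IntD2)
    thus ?case by (intro exI[of _ "B \<inter> B'"]) (auto simp: eventually_conj_iff)
  next
    case (UN K)
    then obtain k where "k \<in> K" "F \<in> k" by blast
    with UN.IH[of k F] show ?case by blast
  qed auto
qed

lemma Hausdorff_space_stone_cech: "Hausdorff_space (stone_cech A)"
  unfolding Hausdorff_space_def
proof (intro allI impI)
  fix F F' assume *: "F \<in> topspace (stone_cech A) \<and> F' \<in> topspace (stone_cech A) \<and> F \<noteq> F'"
  then obtain P where P: "eventually P F" "\<not> eventually P F'"
    using ultrafilters_onD(3) by (metis (full_types) filter_eq_iff topspace_stone_cech)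
  show "\<exists>U V. openin (stone_cech A) U \<and> openin (stone_cech A) V \<and> F \<in> U \<and> F' \<in> V \<and> disjnt U V"
    apply (rule exI[of _ "{F \<in> ultrafilters_on A. eventually P F}"])
    apply (rule exI[of _ "{F \<in> ultrafilters_on A. eventually (\<lambda>x. \<not> P x) F}"])
    using * P by (auto simp: openin_stone_cech_basic disjnt_def ultrafilters_onD(3)[symmetric])
qed

lemma compact_space_stone_cech: "compact_space (stone_cech A)"
  unfolding compact_space_alt
proof (intro allI impI)
  fix \<W> assume W: "(\<forall>W\<in>\<W>. openin (stone_cech A) W) \<and> topspace (stone_cech A) \<subseteq> \<Union>\<W>"
  define \<B> where "\<B> = {B. \<exists>W\<in>\<W>. \<forall>F\<in>ultrafilters_on A. eventually (\<lambda>x. x \<in> B) F \<longrightarrow> F \<in> W}"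
  define L where "L = (INF B\<in>\<B>. principal (A - B))"
  have "\<exists>X\<subseteq>\<B>. finite X \<and> A \<subseteq> \<Union>X"
  proof (rule ccontr)
    assume no: "\<not> ?thesis"
    have "inf (principal A) L = Inf (insert (principal A) ((\<lambda>B. principal (A - B)) ` \<B>))" by (simp add: L_def)
    also have "\<dots> \<noteq> bot"
    proof (rule Inf_filter_not_bot)
      fix X assume X: "X \<subseteq> insert (principal A) ((\<lambda>B. principal (A - B)) ` \<B>)" "finite X"
      then have "X - {principal A} \<subseteq> (\<lambda>B. principal (A - B)) ` \<B>" "finite (X - {principal A})" by auto
      then obtain Y where Y: "Y \<subseteq> \<B>" "finite Y" "X - {principal A} = (\<lambda>B. principal (A - B)) ` Y"
        by (meson finite_subset_image)
      from no Y(1,2) have "\<not> A \<subseteq> \<Union>Y" by metis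
      then obtain a where "a \<in> A" "a \<notin> \<Union>Y" by blast
      have "principal {a} \<le> Inf X"
      proof (rule Inf_greatest)
        fix x assume "x \<in> X"
        then have "x = principal A \<or> x \<in> (\<lambda>B. principal (A - B)) ` Y" using Y by blast
        thus "principal {a} \<le> x" using \<open>a \<in> A\<close> \<open>a \<notin> \<Union>Y\<close> by auto
      qed
      thus "Inf X \<noteq> bot" using bot_unique[of "principal {a}"] by (auto simp: principal_eq_bot_iff)
    qed
    finally obtain U where U: "U \<le> inf (principal A) L" "U \<noteq> bot" "\<forall>P. eventually P U \<or> eventually (\<lambda>x. \<not> P x) U"
      using ultrafilter_exists by blast
    then have uf: "U \<in> ultrafilters_on A" by (auto simp: ultrafilters_on_def)
    with W obtain w where w: "w \<in> \<W>" "U \<in> w" by auto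
    with openin_stone_cech[of A w U] W obtain B where B: "eventually (\<lambda>x. x \<in> B) U" "B \<in> \<B>"
      unfolding \<B>_def by blast
    have "U \<le> principal (A - B)" 
    proof -
      have "L \<le> principal (A - B)" unfolding L_def by (rule INF_lower[OF B(2)])
      with U(1) show ?thesis by (meson inf.boundedE order_trans)
    qed
    hence "eventually (\<lambda>x. x \<notin> B) U" by (auto simp: le_principal elim: eventually_mono)
    with B(1) ultrafilters_onD(3)[OF uf] show False by blast
  qed
  then obtain X where X: "X \<subseteq> \<B>" "finite X" "A \<subseteq> \<Union>X" by blast
  have "\<forall>B\<in>X. \<exists>W\<in>\<W>. \<forall>F\<in>ultrafilters_on A. eventually (\<lambda>x. x \<in> B) F \<longrightarrow> F \<in> W"
    using X(1) by (auto simp: \<B>_def)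
  then obtain w where w: "\<And>B. B \<in> X \<Longrightarrow> w B \<in> \<W>"
      "\<And>B F. B \<in> X \<Longrightarrow> F \<in> ultrafilters_on A \<Longrightarrow> eventually (\<lambda>x. x \<in> B) F \<Longrightarrow> F \<in> w B" by metis
  have "ultrafilters_on A \<subseteq> \<Union>(w ` X)"
  proof
    fix F assume F: "F \<in> ultrafilters_on A"
    have "\<exists>B\<in>X. eventually (\<lambda>x. x \<in> B) F"
    proof (rule ccontr)
      assume "\<not> ?thesis"
      hence "\<forall>B\<in>X. eventually (\<lambda>x. x \<notin> B) F" using ultrafilters_onD(3)[OF F] by blast
      hence "eventually (\<lambda>x. \<forall>B\<in>X. x \<notin> B) F" using X(2) by (simp add: eventually_ball_finite)
      with ultrafilters_onD(2)[OF F] have "eventually (\<lambda>x. False) F" by eventually_elim (use X(3) in auto)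
      with ultrafilters_onD(1)[OF F] show False by (simp add: trivial_limit_def)
    qed
    thus "F \<in> \<Union>(w ` X)" using w(2) F by blast
  qed
  thus "\<exists>\<F>. finite \<F> \<and> \<F> \<subseteq> \<W> \<and> topspace (stone_cech A) \<subseteq> \<Union>\<F>"
    using X(2) w(1) by (intro exI[of _ "w ` X"]) auto
qed

lemma principal_in_ultrafilters_on: "x \<in> A \<Longrightarrow> principal {x} \<in> ultrafilters_on A"
  by (auto simp: ultrafilters_on_def eventually_principal principal_eq_bot_iff)

lemma dense_stone_cech: "stone_cech A closure_of ((\<lambda>x. principal {x}) ` A) = topspace (stone_cech A)"
proof -
  have "\<exists>x\<in>A. principal {x} \<in> W" if W: "openin (stone_cech A) W" "F \<in> W" for F W
  proof -
    obtain B where B: "B \<subseteq> A" "eventually (\<lambda>x. x \<in> B) F"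
        "\<And>F'. F' \<in> ultrafilters_on A \<Longrightarrow> eventually (\<lambda>x. x \<in> B) F' \<Longrightarrow> F' \<in> W"
      using openin_stone_cech[OF W] by blast
    have "F \<in> ultrafilters_on A" using W openin_subset by fastforce
    with B(2) have "B \<noteq> {}" using ultrafilters_onD(1) by (force simp: trivial_limit_def)
    then obtain b where "b \<in> B" by blast
    thus ?thesis using B(1) B(3)[of "principal {b}"] principal_in_ultrafilters_on[of b A]
      by (auto simp: eventually_principal)
  qed
  thus ?thesis unfolding dense_intersects_open by (metis disjoint_iff ex_in_conv image_eqI)
qed

text \<open>The universal property; uniqueness of the extension follows from density.\<close>

lemma stone_cech_extension:
  assumes "compact_space K" "Hausdorff_space K" "f \<in> A \<rightarrow> topspace K"
  shows "\<exists>h. continuous_map (stone_cech A) K h \<and> (\<forall>x\<in>A. h (principal {x}) = f x)"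
proof -
  have ex: "\<exists>l. limitin K f l F" if F: "F \<in> ultrafilters_on A" for F
  proof (rule ccontr)
    assume "\<not> ?thesis"
    then have "\<forall>l\<in>topspace K. \<exists>U. openin K U \<and> l \<in> U \<and> eventually (\<lambda>x. f x \<notin> U) F"
      using ultrafilters_onD(3)[OF F] unfolding limitin_def by metis
    then obtain U where U: "\<And>l. l \<in> topspace K \<Longrightarrow> openin K (U l) \<and> l \<in> U l \<and> eventually (\<lambda>x. f x \<notin> U l) F"
      by metis
    have "(\<forall>V\<in>U ` topspace K. openin K V) \<and> topspace K \<subseteq> \<Union> (U ` topspace K)" using U by blast
    then obtain \<F> where "finite \<F>" "\<F> \<subseteq> U ` topspace K" "topspace K \<subseteq> \<Union>\<F>"
      using assms(1) unfolding compact_space_alt by metis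
    moreover then have "eventually (\<lambda>x. \<forall>V\<in>\<F>. f x \<notin> V) F"
      using U by (intro eventually_ball_finite) auto
    with ultrafilters_onD(2)[OF F] have "eventually (\<lambda>x. False) F"
      by eventually_elim (use assms(3) \<open>topspace K \<subseteq> \<Union>\<F>\<close> in blast)
    with ultrafilters_onD(1)[OF F] show False by (simp add: trivial_limit_def)
  qed
  define h where "h F = (SOME l. limitin K f l F)" for F
  have h: "limitin K f (h F) F" if "F \<in> ultrafilters_on A" for F
    unfolding h_def using ex[OF that] by (rule someI_ex)
  have "regular_space K" using assms compact_Hausdorff_or_regular_imp_normal_space
    compact_Hausdorff_imp_regular_space by blast
  have "openin (stone_cech A) {F \<in> ultrafilters_on A. h F \<in> V}" if V: "openin K V" for V
  proof (subst openin_subopen, intro ballI)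
    fix F assume "F \<in> {F \<in> ultrafilters_on A. h F \<in> V}"
    hence F: "F \<in> ultrafilters_on A" "h F \<in> V" by auto
    obtain U C where UC: "openin K U" "closedin K C" "h F \<in> U" "U \<subseteq> C" "C \<subseteq> V"
      using \<open>regular_space K\<close> V F(2) unfolding neighbourhood_base_of_closedin[symmetric] neighbourhood_base_of
      by metis
    have "eventually (\<lambda>x. f x \<in> U) F" using h[OF F(1)] UC by (auto simp: limitin_def)
    moreover have "h F' \<in> V" if F': "F' \<in> ultrafilters_on A" "eventually (\<lambda>x. f x \<in> U) F'" for F'
    proof (rule ccontr)
      assume "h F' \<notin> V"
      hence "h F' \<in> topspace K - C" using h[OF F'(1)] UC by (auto simp: limitin_def)
      moreover have "openin K (topspace K - C)" using UC by blast
      ultimately have "eventually (\<lambda>x. f x \<in> topspace K - C) F'" using h[OF F'(1)] by (auto simp: limitin_def)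
      with F'(2) have "eventually (\<lambda>x. False) F'" by eventually_elim (use UC in auto)
      with ultrafilters_onD(1)[OF F'(1)] show False by (simp add: trivial_limit_def)
    qed
    ultimately show "\<exists>T. openin (stone_cech A) T \<and> F \<in> T \<and> T \<subseteq> {F \<in> ultrafilters_on A. h F \<in> V}"
      using F openin_stone_cech_basic[of A "\<lambda>x. f x \<in> U"]
      by (intro exI[of _ "{F \<in> ultrafilters_on A. eventually (\<lambda>x. f x \<in> U) F}"]) auto
  qed
  moreover have "h \<in> ultrafilters_on A \<rightarrow> topspace K"
    using h unfolding limitin_def by blast
  ultimately have "continuous_map (stone_cech A) K h"
    unfolding continuous_map_def topspace_stone_cech by blast
  moreover have "h (principal {x}) = f x" if "x \<in> A" for x
  proof -
    have 1: "limitin K f (h (principal {x})) (principal {x})"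
      by (rule h[OF principal_in_ultrafilters_on[OF that]])
    have 2: "limitin K f (f x) (principal {x})"
      using assms(3) that unfolding limitin_def eventually_principal by blast
    have 3: "principal {x} \<noteq> bot" by (simp add: principal_eq_bot_iff)
    show ?thesis by (rule limitin_Hausdorff_unique[OF 1 2 3 assms(2)])
  qed
  ultimately show ?thesis by blast
qed

context group begin

text \<open>\<^const>\<open>stone_cech_act\<close> is the action by homeomorphisms extending left multiplication.\<close>

lemma stone_cech_act_closed:
  assumes "g \<in> carrier G" "F \<in> ultrafilters_on (carrier G)"
  shows "stone_cech_act G g F \<in> ultrafilters_on (carrier G)"
proof -
  have "eventually (\<lambda>x. g \<otimes> x \<in> carrier G) F"
    using ultrafilters_onD(2)[OF assms(2)] by eventually_elim (simp add: assms(1))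
  moreover have "eventually (\<lambda>x. P (g \<otimes> x)) F \<or> eventually (\<lambda>x. \<not> P (g \<otimes> x)) F" for P
    using ultrafilters_onD(3)[OF assms(2)] by blast
  ultimately show ?thesis
    using ultrafilters_onD(1)[OF assms(2)]
    by (simp add: ultrafilters_on_def stone_cech_act_def eventually_filtermap filtermap_bot_iff le_principal)
qed

lemma continuous_map_stone_cech_act:
  assumes "g \<in> carrier G"
  shows "continuous_map (stone_cech (carrier G)) (stone_cech (carrier G)) (stone_cech_act G g)"
  unfolding stone_cech_def[of "carrier G"]
proof (rule continuous_on_generated_topo, fold stone_cech_def)
  fix U assume "U \<in> (\<lambda>B. {F \<in> ultrafilters_on (carrier G). eventually (\<lambda>x. x \<in> B) F}) ` Pow (carrier G)"
  then obtain B where U: "U = {F \<in> ultrafilters_on (carrier G). eventually (\<lambda>x. x \<in> B) F}" by blast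
  have "stone_cech_act G g -` U \<inter> topspace (stone_cech (carrier G)) =
     {F \<in> ultrafilters_on (carrier G). eventually (\<lambda>x. g \<otimes> x \<in> B) F}"
    using stone_cech_act_closed[OF assms] by (auto simp: U) (auto simp: stone_cech_act_def eventually_filtermap)
  then show "openin (stone_cech (carrier G)) (stone_cech_act G g -` U \<inter> topspace (stone_cech (carrier G)))"
    by (simp add: openin_stone_cech_basic)
next
  show "stone_cech_act G g ` topspace (stone_cech (carrier G))
   \<subseteq> \<Union> ((\<lambda>B. {F \<in> ultrafilters_on (carrier G). eventually (\<lambda>x. x \<in> B) F}) ` Pow (carrier G))"
    (is "_ \<subseteq> ?T")
  proof -
    have "?T = ultrafilters_on (carrier G)"
      by (rule topspace_stone_cech[of "carrier G", unfolded stone_cech_def topology_generated_by_topspace])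
    thus ?thesis unfolding topspace_stone_cech using stone_cech_act_closed[OF assms] by (metis image_subsetI)
  qed
qed

lemma stone_cech_act_principal:
  "stone_cech_act G g (principal {x}) = principal {g \<otimes> x}"
  by (simp add: stone_cech_act_def)

lemma stone_cech_act_one:
  assumes "F \<in> ultrafilters_on (carrier G)"
  shows "stone_cech_act G \<one> F = F"
proof -
  have "eventually P (filtermap (\<lambda>x. \<one> \<otimes> x) F) = eventually P F" for P
    unfolding eventually_filtermap
    by (rule eventually_cong[OF ultrafilters_onD(2)[OF assms]]) simp
  thus ?thesis by (simp add: stone_cech_act_def filter_eq_iff)
qed

lemma stone_cech_act_mult:
  assumes "g \<in> carrier G" "h \<in> carrier G" "F \<in> ultrafilters_on (carrier G)"
  shows "stone_cech_act G (g \<otimes> h) F = stone_cech_act G g (stone_cech_act G h F)"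
proof -
  have "eventually (\<lambda>x. P (g \<otimes> h \<otimes> x)) F = eventually (\<lambda>x. P (g \<otimes> (h \<otimes> x))) F" for P
    by (rule eventually_cong[OF ultrafilters_onD(2)[OF assms(3)]]) (simp add: m_assoc assms)
  thus ?thesis by (simp add: stone_cech_act_def filter_eq_iff eventually_filtermap)
qed

end

end

theory Submission
  imports Defs
begin

text \<open>
  If \<open>G\<close> is virtually cyclic, then the cover whose only member is \<open>G \<times> \<beta>G\<close> is admissible for every
  \<open>\<alpha>\<close>, and it has dimension \<open>0\<close>.

  Conversely, take an open \<open>VCyc\<close>-cover of dimension \<open>0\<close> with Lebesgue number \<open>1\<close>. Its members are
  pairwise disjoint, so two points \<open>(g, y)\<close> and \<open>(g s, y)\<close> with \<open>s\<close> a generator always lie in the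
  same member. The Cayley graph of \<open>G\<close> is connected; hence each member is of the form \<open>G \<times> V\<close>, and
  the nonempty sets \<open>V\<close> form a partition of \<open>\<beta>G\<close> into open sets
  (\<open>member_contains_column\<close>). By compactness the partition is finite. Since \<open>G\<close> permutes the
  members, the stabiliser of a nonempty one has finite index (\<open>finite_index_stabiliser\<close>). This
  stabiliser is virtually cyclic, and so is every group having a virtually cyclic subgroup of finite
  index (\<open>virtually_cyclic_finite_index\<close>).

  Of \<open>\<beta>G\<close> the argument uses only that it is a nonempty compact \<open>G\<close>-space, and the converse produces
  a finite index member of any given family \<open>\<F>\<close> of subgroups (\<open>eq_asdim_prod_le_0_imp_finite_index\<close>).
\<close>

section \<open>Subgroups of finite index\<close>

text \<open>A coset \<open>C g\<close> with \<open>g = h r\<close>, where \<open>r\<close> represents \<open>H g\<close>, is the translate by \<open>r\<close> of the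
  coset \<open>C h\<close> inside \<open>H\<close>; this leaves finitely many choices for each factor.\<close>

lemma (in group) finite_rcosets_trans:
  assumes H: "subgroup H G" and C: "subgroup C (G\<lparr>carrier := H\<rparr>)"
    and finH: "finite (rcosets H)" and finC: "finite (rcosets\<^bsub>G\<lparr>carrier := H\<rparr>\<^esub> C)"
  shows "finite (rcosets C)"
proof -
  have CG: "subgroup C G" by (rule incl_subgroup[OF H C])
  note Hsub = subgroup.subset[OF H] and Csub = subgroup.subset[OF CG]
  have "\<exists>r\<in>carrier G. D = H #> r" if "D \<in> rcosets H" for D
    using that by (auto simp: RCOSETS_def)
  then obtain rep where rep: "\<And>D. D \<in> rcosets H \<Longrightarrow> rep D \<in> carrier G \<and> D = H #> rep D"
    by metis
  have "rcosets C \<subseteq> (\<lambda>(D, E). E #> rep D) ` ((rcosets H) \<times> (rcosets\<^bsub>G\<lparr>carrier := H\<rparr>\<^esub> C))"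
  proof
    fix E assume "E \<in> rcosets C"
    then obtain g where g: "g \<in> carrier G" "E = C #> g" by (auto simp: RCOSETS_def)
    have D: "H #> g \<in> rcosets H" using g Hsub by (simp add: rcosetsI)
    let ?r = "rep (H #> g)"
    have r: "?r \<in> carrier G" "H #> g = H #> ?r" using rep[OF D] by auto
    have "g \<in> H #> g" by (rule rcos_self[OF g(1) H])
    then obtain h where h: "h \<in> H" "g = h \<otimes> ?r" using r(2) by (auto simp: r_coset_def)
    have hG: "h \<in> carrier G" using h Hsub by blast
    have "C #> h \<in> rcosets\<^bsub>G\<lparr>carrier := H\<rparr>\<^esub> C"
      using h(1) by (auto simp: RCOSETS_def r_coset_def)
    moreover have "E = (C #> h) #> ?r"
      using g(2) h(2) coset_mult_assoc[OF Csub hG r(1)] by simp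
    ultimately show "E \<in> (\<lambda>(D, E). E #> rep D) ` ((rcosets H) \<times> (rcosets\<^bsub>G\<lparr>carrier := H\<rparr>\<^esub> C))"
      using D by force
  qed
  then show ?thesis by (rule finite_subset) (simp add: finH finC)
qed

lemma (in group) virtually_cyclic_finite_index:
  assumes H: "subgroup H G" and fin: "finite (rcosets H)"
    and vc: "virtually_cyclic (G\<lparr>carrier := H\<rparr>)"
  shows "virtually_cyclic G"
proof -
  obtain C where C: "subgroup C (G\<lparr>carrier := H\<rparr>)" "cyclic_group (G\<lparr>carrier := C\<rparr>)"
      "finite (rcosets\<^bsub>G\<lparr>carrier := H\<rparr>\<^esub> C)"
    using vc unfolding virtually_cyclic_def by auto
  show ?thesis
    unfolding virtually_cyclic_def
    using incl_subgroup[OF H C(1)] C(2) finite_rcosets_trans[OF H C(1) fin C(3)] by blast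
qed


section \<open>Group actions and stabilisers of subsets\<close>

text \<open>The laws are required on \<open>Y\<close> only, since \<^const>\<open>stone_cech_act\<close> need not satisfy them
  at filters that do not contain the carrier.\<close>

locale G_set = group G for G (structure) +
  fixes Y :: "'y set" and act :: "'a \<Rightarrow> 'y \<Rightarrow> 'y"
  assumes act_closed: "\<And>g y. g \<in> carrier G \<Longrightarrow> y \<in> Y \<Longrightarrow> act g y \<in> Y"
    and act_one: "\<And>y. y \<in> Y \<Longrightarrow> act \<one> y = y"
    and act_mult: "\<And>g h y. g \<in> carrier G \<Longrightarrow> h \<in> carrier G \<Longrightarrow> y \<in> Y \<Longrightarrow>
                     act (g \<otimes> h) y = act g (act h y)"
begin

lemma image_act_one: "U \<subseteq> Y \<Longrightarrow> act \<one> ` U = U"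
  using act_one by (force simp: image_iff)

lemma image_act_mult:
  assumes "g \<in> carrier G" "h \<in> carrier G" "U \<subseteq> Y"
  shows "act (g \<otimes> h) ` U = act g ` act h ` U"
  unfolding image_image using assms by (intro image_cong refl act_mult) auto

lemma image_act_self:
  assumes "g \<in> carrier G"
  shows "act g ` Y = Y"
proof
  show "act g ` Y \<subseteq> Y" using act_closed assms by blast
  have "Y = act g ` act (inv g) ` Y"
    using image_act_mult[of g "inv g" Y] image_act_one[of Y] assms by simp
  also have "\<dots> \<subseteq> act g ` Y" using act_closed assms by (intro image_mono) auto
  finally show "Y \<subseteq> act g ` Y" .
qed

text \<open>Right cosets of the stabiliser are determined by the translate \<open>g\<inverse> U\<close>, as in the
  orbit-stabiliser theorem.\<close>

lemma finite_index_stabiliser: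
  assumes U: "U \<subseteq> Y" and fin: "finite ((\<lambda>g. act g ` U) ` carrier G)"
    and H: "subgroup {g \<in> carrier G. act g ` U = U} G"
  shows "finite (rcosets {g \<in> carrier G. act g ` U = U})"
proof -
  let ?H = "{g \<in> carrier G. act g ` U = U}"
  have same: "?H #> g = ?H #> g'"
    if g: "g \<in> carrier G" and g': "g' \<in> carrier G" and eq: "act (inv g) ` U = act (inv g') ` U" for g g'
  proof -
    have "act (g \<otimes> inv g') ` U = act g ` act (inv g) ` U"
      using image_act_mult[of g "inv g'" U] g g' U eq by simp
    also have "\<dots> = U" using image_act_mult[of g "inv g" U] g U image_act_one by simp
    finally have "g \<otimes> inv g' \<in> ?H" using g g' by simp
    moreover have "g = (g \<otimes> inv g') \<otimes> g'" using g g' by (simp add: m_assoc)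
    ultimately have "g \<in> ?H #> g'" unfolding r_coset_def by blast
    then show ?thesis using repr_independence[OF _ g' H] by auto
  qed
  define f where "f V = ?H #> (SOME g. g \<in> carrier G \<and> act (inv g) ` U = V)" for V
  have "rcosets ?H \<subseteq> f ` ((\<lambda>g. act g ` U) ` carrier G)"
  proof
    fix D assume "D \<in> rcosets ?H"
    then obtain g where g: "g \<in> carrier G" "D = ?H #> g" by (auto simp: RCOSETS_def)
    let ?P = "\<lambda>k. k \<in> carrier G \<and> act (inv k) ` U = act (inv g) ` U"
    have "?P (SOME k. ?P k)" by (rule someI[of ?P g]) (simp add: g)
    then have "f (act (inv g) ` U) = D"
      unfolding f_def g(2) using g(1) by (intro same) auto
    then show "D \<in> f ` ((\<lambda>g. act g ` U) ` carrier G)" using g(1) by force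
  qed
  then show ?thesis using fin by (meson finite_imageI finite_subset)
qed

lemma G_set_diag: "G_set G (carrier G \<times> Y) (diag_act G act)"
  by unfold_locales (auto simp: diag_act_def act_closed act_one act_mult m_assoc)

end


section \<open>Covers of dimension zero\<close>

lemma cover_dim_le_0D:
  assumes dim: "cover_dim Y \<U> \<le> 0" and y: "y \<in> Y" and "U \<in> \<U>" "V \<in> \<U>" "y \<in> U" "y \<in> V"
  shows "U = V"
proof -
  let ?c = "\<lambda>y. if finite {U \<in> \<U>. y \<in> U} then enat (card {U \<in> \<U>. y \<in> U}) else \<infinity>"
  have "ereal_of_enat (SUP y\<in>Y. ?c y) \<le> 1"
    using dim unfolding cover_dim_def
    by (cases "ereal_of_enat (SUP y\<in>Y. ?c y)") (auto simp: one_ereal_def zero_ereal_def)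
  then have "(SUP y\<in>Y. ?c y) \<le> 1"
    by (cases "SUP y\<in>Y. ?c y") (auto simp: one_enat_def)
  then have "?c y \<le> 1" by (rule order_trans[OF SUP_upper[OF y]])
  then have "finite {U \<in> \<U>. y \<in> U}" "card {U \<in> \<U>. y \<in> U} \<le> Suc 0"
    by (auto simp: one_enat_def split: if_splits)
  then show ?thesis using assms(3-) by (auto simp: card_le_Suc0_iff_eq)
qed

lemma cover_dim_nonneg:
  assumes "\<Union>\<U> = Y" and "Y \<noteq> {}"
  shows "0 \<le> cover_dim Y \<U>"
proof -
  let ?c = "\<lambda>y. if finite {U \<in> \<U>. y \<in> U} then enat (card {U \<in> \<U>. y \<in> U}) else \<infinity>"
  obtain y U where y: "y \<in> Y" "U \<in> \<U>" "y \<in> U" using assms by blast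
  then have "finite {U \<in> \<U>. y \<in> U} \<Longrightarrow> 0 < card {U \<in> \<U>. y \<in> U}" by (auto simp: card_gt_0_iff)
  then have "1 \<le> ?c y" by (auto simp: one_enat_def)
  also have "\<dots> \<le> (SUP y\<in>Y. ?c y)" by (rule SUP_upper[OF y(1)])
  finally have "1 \<le> ereal_of_enat (SUP y\<in>Y. ?c y)"
    by (cases "SUP y\<in>Y. ?c y") (auto simp: one_enat_def)
  then show ?thesis unfolding cover_dim_def
    by (cases "ereal_of_enat (SUP y\<in>Y. ?c y)") (auto simp: one_ereal_def zero_ereal_def)
qed

lemma cover_dim_singleton: "cover_dim Y {Y} \<le> 0"
proof -
  let ?c = "\<lambda>y. if finite {U \<in> {Y}. y \<in> U} then enat (card {U \<in> {Y}. y \<in> U}) else \<infinity>"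
  have "?c y \<le> 1" for y
  proof -
    have "{U \<in> {Y}. y \<in> U} \<subseteq> {Y}" by blast
    then have "card {U \<in> {Y}. y \<in> U} \<le> 1" using card_mono[of "{Y}"] by force
    then show ?thesis by (simp add: one_enat_def)
  qed
  then have "(SUP y\<in>Y. ?c y) \<le> 1" by (intro SUP_least) auto
  then have "ereal_of_enat (SUP y\<in>Y. ?c y) \<le> 1"
    by (cases "SUP y\<in>Y. ?c y") (auto simp: one_enat_def)
  then show ?thesis unfolding cover_dim_def
    by (cases "ereal_of_enat (SUP y\<in>Y. ?c y)") (auto simp: one_ereal_def zero_ereal_def)
qed

context group begin

lemma one_in_word_cball:
  assumes "g \<in> carrier G"
  shows "g \<in> word_cball G S g 1"
proof -
  have "word_length G S \<one> \<le> 0"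
    unfolding word_length_def by (rule Least_le) auto
  then show ?thesis using assms by (simp add: word_cball_def word_dist_def)
qed

lemma generator_in_word_cball:
  assumes "g \<in> carrier G" "s \<in> S \<union> (\<lambda>s. inv s) ` S" "S \<subseteq> carrier G"
  shows "g \<otimes> s \<in> word_cball G S g 1"
proof -
  have s: "s \<in> carrier G" using assms by auto
  have "word_length G S s \<le> 1"
    unfolding word_length_def
    by (rule Least_le, rule exI[of _ "[s]"]) (use assms s in auto)
  then show ?thesis using assms(1) s
    by (simp add: word_cball_def word_dist_def m_assoc[symmetric])
qed

text \<open>Multiplying by a generator does not leave the unit ball, and a ball over \<open>y\<close> is contained in
  one member; disjointness identifies that member with \<open>U\<close>. Induction on the
  expression of \<open>g\<inverse> k\<close> in the generators does the rest.\<close>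

lemma member_contains_column:
  assumes S: "S \<subseteq> carrier G" and gen: "generate G S = carrier G"
    and disj: "\<And>p U V. p \<in> carrier G \<times> Y \<Longrightarrow> U \<in> \<U> \<Longrightarrow> V \<in> \<U> \<Longrightarrow> p \<in> U \<Longrightarrow> p \<in> V \<Longrightarrow> U = V"
    and leb: "G_Lebesgue_number G S Y \<U> 1"
    and U: "U \<in> \<U>" and y: "y \<in> Y" and g: "g \<in> carrier G" "(g, y) \<in> U" and k: "k \<in> carrier G"
  shows "(k, y) \<in> U"
proof -
  have step: "(g \<otimes> s, y) \<in> U"
    if g: "g \<in> carrier G" "(g, y) \<in> U" and s: "s \<in> S \<union> (\<lambda>s. inv s) ` S" for g s
  proof -
    obtain V where V: "V \<in> \<U>" "word_cball G S g 1 \<times> {y} \<subseteq> V"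
      using leb g y unfolding G_Lebesgue_number_def by blast
    have "(g, y) \<in> V" using V one_in_word_cball[OF g(1)] by blast
    then have "V = U" using disj[of "(g, y)" V U] V U g y by blast
    then show ?thesis using V generator_in_word_cball[OF g(1) s S] by blast
  qed
  have gen_step: "(g \<otimes> k, y) \<in> U" if "k \<in> generate G S" "g \<in> carrier G" "(g, y) \<in> U" for k g
    using that
  proof (induction arbitrary: g rule: generate.induct)
    case (eng h1 h2)
    have "h1 \<in> carrier G" "h2 \<in> carrier G" using eng.hyps gen by auto
    then show ?case using eng by (simp add: m_assoc[symmetric])
  qed (auto intro: step)
  have "(g \<otimes> (inv g \<otimes> k), y) \<in> U" using gen_step g k gen by simp
  then show ?thesis using g k by (simp add: m_assoc[symmetric])
qed

end


section \<open>Vanishing of the equivariant asymptotic dimension\<close>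

lemma eq_asdim_prod_le_0D:
  assumes "eq_asdim_prod G S \<F> X act \<le> 0"
  obtains \<U> where "F_cover G \<F> (carrier G \<times> topspace X) (diag_act G act) \<U>"
    "\<And>U. U \<in> \<U> \<Longrightarrow> openin (prod_topology (discrete_topology (carrier G)) X) U"
    "cover_dim (carrier G \<times> topspace X) \<U> \<le> 0"
    "G_Lebesgue_number G S (topspace X) \<U> \<alpha>"
proof -
  have "eq_asdim_prod G S \<F> X act < 1" using assms by (rule order_le_less_trans) simp
  then obtain n :: int where n: "ereal (of_int n) < 1"
    and cov: "\<forall>\<alpha>::real. \<exists>\<U>.
         F_cover G \<F> (carrier G \<times> topspace X) (diag_act G act) \<U> \<and>
         (\<forall>U\<in>\<U>. openin (prod_topology (discrete_topology (carrier G)) X) U) \<and>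
         cover_dim (carrier G \<times> topspace X) \<U> \<le> ereal (of_int n) \<and>
         G_Lebesgue_number G S (topspace X) \<U> \<alpha>"
    unfolding eq_asdim_prod_def Inf_less_iff by blast
  have "ereal (of_int n) \<le> 0" using n by (simp add: one_ereal_def zero_ereal_def)
  then show ?thesis using cov that by (meson order_trans)
qed

locale G_space = G_set G "topspace X" act for G (structure) and X :: "'x topology" and act +
  assumes nonempty: "topspace X \<noteq> {}" and compact: "compact_space X"
begin

theorem eq_asdim_prod_le_0_imp_finite_index:
  assumes S: "S \<subseteq> carrier G" and gen: "generate G S = carrier G"
    and \<F>: "\<And>H. H \<in> \<F> \<Longrightarrow> subgroup H G"
    and dim: "eq_asdim_prod G S \<F> X act \<le> 0"
  shows "\<exists>H\<in>\<F>. finite (rcosets H)"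
proof -
  let ?Y = "carrier G \<times> topspace X" and ?act = "diag_act G act"
  interpret diag: G_set G ?Y ?act by (rule G_set_diag)
  obtain \<U> where cov: "F_cover G \<F> ?Y ?act \<U>"
    and op: "\<And>U. U \<in> \<U> \<Longrightarrow> openin (prod_topology (discrete_topology (carrier G)) X) U"
    and dim0: "cover_dim ?Y \<U> \<le> 0" and leb: "G_Lebesgue_number G S (topspace X) \<U> 1"
    using eq_asdim_prod_le_0D[OF dim, where \<alpha> = 1] by metis
  have union: "\<Union>\<U> = ?Y" and F: "\<And>U. U \<in> \<U> \<Longrightarrow> F_subset G \<F> ?Y ?act U"
    and invar: "\<And>g U. g \<in> carrier G \<Longrightarrow> U \<in> \<U> \<Longrightarrow> ?act g ` U \<in> \<U>"
    using cov unfolding F_cover_def by auto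
  note disj = cover_dim_le_0D[OF dim0]
  have column: "(k, y) \<in> U" if "U \<in> \<U>" "(g, y) \<in> U" "k \<in> carrier G" for U g k y
  proof -
    have "(g, y) \<in> ?Y" using that(1,2) union by blast
    then have "y \<in> topspace X" "g \<in> carrier G" by auto
    from member_contains_column[OF S gen _ leb that(1) this that(2,3)]
    show ?thesis using disj by blast
  qed

  define slice where "slice U = {y \<in> topspace X. (\<one>, y) \<in> U}" for U
  have "openin X (slice U)" if "U \<in> \<U>" for U
  proof -
    have "continuous_map X (prod_topology (discrete_topology (carrier G)) X) (\<lambda>y. (\<one>, y))"
      by (auto intro: continuous_map_pairedI)
    then show ?thesis unfolding slice_def using op[OF that] by (rule openin_continuous_map_preimage)
  qed
  moreover have "topspace X \<subseteq> \<Union>(slice ` \<U>)"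
    using union by (fastforce simp: slice_def)
  ultimately obtain \<C> where "finite \<C>" "\<C> \<subseteq> slice ` \<U>" and cover: "topspace X \<subseteq> \<Union>\<C>"
    using compact unfolding compact_space_alt by (metis imageE)
  then obtain \<V> where \<V>: "finite \<V>" "\<V> \<subseteq> \<U>" "\<C> = slice ` \<V>"
    by (meson finite_subset_image)
  \<comment> \<open>The empty set may belong to the cover, so only the nonempty members are counted.\<close>
  have "U \<in> \<V>" if U: "U \<in> \<U>" "U \<noteq> {}" for U
  proof -
    obtain g y where gy: "(g, y) \<in> U" using U(2) by auto
    have "(g, y) \<in> ?Y" using gy U(1) union by blast
    then have y: "y \<in> topspace X" by simp
    have one: "(\<one>, y) \<in> U" by (rule column[OF U(1) gy one_closed])
    obtain V where V: "V \<in> \<V>" "(\<one>, y) \<in> V" using y cover \<V>(3) by (auto simp: slice_def)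
    then have "V = U" using disj[of "(\<one>, y)" V U] one y U(1) \<V>(2) by auto
    then show ?thesis using V by simp
  qed
  then have "\<U> - {{}} \<subseteq> \<V>" by blast
  then have fin: "finite (\<U> - {{}})" using \<V>(1) by (rule finite_subset)

  obtain U where U: "U \<in> \<U>" "U \<noteq> {}" using union nonempty by fastforce
  have "(\<lambda>g. ?act g ` U) ` carrier G \<subseteq> \<U> - {{}}" using invar U by auto
  then have "finite ((\<lambda>g. ?act g ` U) ` carrier G)" using fin finite_subset by blast
  moreover have stab: "{g \<in> carrier G. ?act g ` U = U} \<in> \<F>" and "U \<subseteq> ?Y"
    using F[OF U(1)] unfolding F_subset_def by auto
  ultimately show ?thesis using diag.finite_index_stabiliser \<F> by blast
qed

text \<open>The one-element cover gives the upper bound; the value \<open>-1\<close> is excluded because the space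
  is nonempty.\<close>

lemma eq_asdim_prod_eq_0I:
  assumes "carrier G \<in> \<F>"
  shows "eq_asdim_prod G S \<F> X act = 0"
proof -
  let ?Y = "carrier G \<times> topspace X" and ?act = "diag_act G act"
  interpret diag: G_set G ?Y ?act by (rule G_set_diag)
  let ?adm = "\<lambda>n::int. \<forall>\<alpha>::real. \<exists>\<U>. F_cover G \<F> ?Y ?act \<U> \<and>
         (\<forall>U\<in>\<U>. openin (prod_topology (discrete_topology (carrier G)) X) U) \<and>
         cover_dim ?Y \<U> \<le> ereal (of_int n) \<and> G_Lebesgue_number G S (topspace X) \<U> \<alpha>"
  have stab: "{g \<in> carrier G. ?act g ` ?Y = ?Y} = carrier G" using diag.image_act_self by blast
  have "F_subset G \<F> ?Y ?act ?Y"
    unfolding F_subset_def stab using assms diag.image_act_self by simp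
  then have "F_cover G \<F> ?Y ?act {?Y}"
    unfolding F_cover_def using diag.image_act_self by simp
  moreover have "openin (prod_topology (discrete_topology (carrier G)) X) ?Y"
    by (simp add: openin_prod_Times_iff)
  moreover have "G_Lebesgue_number G S (topspace X) {?Y} \<alpha>" for \<alpha>
    by (auto simp: G_Lebesgue_number_def word_cball_def)
  ultimately have adm: "?adm 0"
    using cover_dim_singleton[of ?Y] by (auto simp: zero_ereal_def intro!: exI[of _ "{?Y}"])
  have nonneg: "0 \<le> ereal (of_int n)" if n: "?adm n" for n
  proof -
    obtain \<U> where "F_cover G \<F> ?Y ?act \<U>" and le: "cover_dim ?Y \<U> \<le> ereal (of_int n)"
      using n by blast
    then have "\<Union>\<U> = ?Y" by (simp add: F_cover_def)
    moreover have "?Y \<noteq> {}" using nonempty one_closed by blast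
    ultimately show ?thesis using cover_dim_nonneg le order_trans by blast
  qed
  show ?thesis unfolding eq_asdim_prod_def
  proof (rule antisym)
    show "Inf {ereal (of_int n) |n. ?adm n} \<le> 0"
      using adm by (intro Inf_lower) (force simp: zero_ereal_def)
    show "0 \<le> Inf {ereal (of_int n) |n. ?adm n}"
      using nonneg by (intro Inf_greatest) blast
  qed
qed

theorem eq_asdim_prod_VCyc_eq_0_iff:
  assumes "S \<subseteq> carrier G" and "generate G S = carrier G"
  shows "eq_asdim_prod G S (VCyc G) X act = 0 \<longleftrightarrow> virtually_cyclic G"
proof
  assume "eq_asdim_prod G S (VCyc G) X act = 0"
  then obtain H where "H \<in> VCyc G" "finite (rcosets H)"
    using eq_asdim_prod_le_0_imp_finite_index[OF assms, of "VCyc G"] by (auto simp: VCyc_def)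
  then show "virtually_cyclic G"
    using virtually_cyclic_finite_index by (auto simp: VCyc_def)
next
  assume "virtually_cyclic G"
  then have "carrier G \<in> VCyc G" by (simp add: VCyc_def subgroup_self)
  then show "eq_asdim_prod G S (VCyc G) X act = 0" by (rule eq_asdim_prod_eq_0I)
qed

end

lemma (in group) G_space_stone_cech: "G_space G (stone_cech (carrier G)) (stone_cech_act G)"
  using principal_in_ultrafilters_on[OF one_closed]
  by unfold_locales
     (auto simp: stone_cech_act_closed stone_cech_act_one stone_cech_act_mult compact_space_stone_cech)

theorem corollary1p15:
  fixes G :: "('a, 'b) monoid_scheme" and S :: "'a set"
  assumes "group G"
    and "finite S" and "S \<subseteq> carrier G" and "generate G S = carrier G"
  shows "eq_asdim G S (VCyc G) = 0 \<longleftrightarrow> virtually_cyclic G"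
proof -
  interpret G_space G "stone_cech (carrier G)" "stone_cech_act G"
    by (rule group.G_space_stone_cech[OF assms(1)])
  show ?thesis
    unfolding eq_asdim_def by (rule eq_asdim_prod_VCyc_eq_0_iff[OF assms(3,4)])
qed

end
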